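(* There exist functions $f_n:\{0,1\}^n\times\{0,1\}^n\to\{0,1\}$, $n\ge1$, for which $GH(f_n)$ is exponential in $n$.
   Context: Exponential means $2^{\Omega(n)}$: there is a constant $c>0$ with $GH(f_n)\ge 2^{cn}$ for all sufficiently large $n$. Garden-hose game of size $s\in\mathbb{N}$: let $A=\{1^A,\dots,s^A\}$, $B=\{1^B,\dots,s^B\}$, $A_\circ=A\cup\{0\}$, and $E=\{\{i^A,i^B\}:1\le i\le s\}$ (the pipes). A game $G$ is given by functions $E_{A_\circ},E_B$ on $\{0,1\}^n$, where $E_{A_\circ}(x)$ is a set of edges (no self-loops) on $A_\circ$ and $E_B(y)$ is a set of edges (no self-loops) on $B$, such that the graphs $(A_\circ,E_{A_\circ}(x))$ and $(B,E_B(y))$ have maximum degree at most $1$. Put $G(x,y)=(A_\circ\cup B,\,E\cup E_{A_\circ}(x)\cup E_B(y))$. There is a unique maximal path $\pi(x,y)$ in $G(x,y)$ starting at $0$ (it consists of $0$ alone if $0$ has degree $0$). $G$ computes a function $h:\{0,1\}^n\times\{0,1\}^n\to\{0,1\}$ if for all $x,y$ the endpoint of $\pi(x,y)$ lies in $A_\circ$ when $h(x,y)=0$ and in $B$ when $h(x,y)=1$. $GH(h)$ is the smallest size $s$ of a game computing $h$. *)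

theory Defs
  imports Complex_Main
begin

text \<open>Undirected simple graphs are given by a vertex set and a set of two-element vertex sets.\<close>

definition all_edges :: "'v set \<Rightarrow> 'v set set" where
  "all_edges V = {{u, v} | u v. u \<in> V \<and> v \<in> V \<and> u \<noteq> v}"

definition degree :: "'v set set \<Rightarrow> 'v \<Rightarrow> nat" where
  "degree E v = card {e \<in> E. v \<in> e}"

definition is_path :: "'v set \<Rightarrow> 'v set set \<Rightarrow> 'v list \<Rightarrow> bool" where
  "is_path V E p \<longleftrightarrow>
     p \<noteq> [] \<and> set p \<subseteq> V \<and> distinct p \<and> successively (\<lambda>u v. {u, v} \<in> E) p"

definition maximal_path_from :: "'v set \<Rightarrow> 'v set set \<Rightarrow> 'v \<Rightarrow> 'v list \<Rightarrow> bool" where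
  "maximal_path_from V E v p \<longleftrightarrow>
     is_path V E p \<and> hd p = v \<and> \<not> (\<exists>q. q \<noteq> [] \<and> is_path V E (p @ q))"

datatype vertex = Source | PipeA nat | PipeB nat

definition A_side :: "nat \<Rightarrow> vertex set" where
  "A_side s = PipeA ` {1..s}"

definition B_side :: "nat \<Rightarrow> vertex set" where
  "B_side s = PipeB ` {1..s}"

definition A0_side :: "nat \<Rightarrow> vertex set" where
  "A0_side s = A_side s \<union> {Source}"

definition pipes :: "nat \<Rightarrow> vertex set set" where
  "pipes s = {{PipeA i, PipeB i} | i. 1 \<le> i \<and> i \<le> s}"

text \<open>
  An element of $\{0,1\}^n$ is a Boolean list of length \<open>n\<close>, with \<open>True\<close> for 1. Functions on
  $\{0,1\}^n$ are total functions on lists; their values on lists of other lengths are never used.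
\<close>

type_synonym strategy = "bool list \<Rightarrow> vertex set set"

definition garden_hose_game :: "nat \<Rightarrow> nat \<Rightarrow> strategy \<Rightarrow> strategy \<Rightarrow> bool" where
  "garden_hose_game n s EA EB \<longleftrightarrow>
     (\<forall>x. length x = n \<longrightarrow> EA x \<subseteq> all_edges (A0_side s) \<and> (\<forall>v \<in> A0_side s. degree (EA x) v \<le> 1)) \<and>
     (\<forall>y. length y = n \<longrightarrow> EB y \<subseteq> all_edges (B_side s) \<and> (\<forall>v \<in> B_side s. degree (EB y) v \<le> 1))"

text \<open>
  The maximal path is unique in a game: every vertex has degree at most 2 in the combined graph,
  and \<open>Source\<close> lies on no pipe, so it has degree at most 1.
\<close>

definition game_path ::
  "nat \<Rightarrow> strategy \<Rightarrow> strategy \<Rightarrow> bool list \<Rightarrow> bool list \<Rightarrow> vertex list" where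
  "game_path s EA EB x y =
     (THE p. maximal_path_from (A0_side s \<union> B_side s) (pipes s \<union> EA x \<union> EB y) Source p)"

definition computes ::
  "nat \<Rightarrow> nat \<Rightarrow> strategy \<Rightarrow> strategy \<Rightarrow> (bool list \<Rightarrow> bool list \<Rightarrow> bool) \<Rightarrow> bool" where
  "computes n s EA EB h \<longleftrightarrow>
     (\<forall>x y. length x = n \<longrightarrow> length y = n \<longrightarrow>
        (\<not> h x y \<longrightarrow> last (game_path s EA EB x y) \<in> A0_side s) \<and>
        (h x y \<longrightarrow> last (game_path s EA EB x y) \<in> B_side s))"

text \<open>
  Every function is computed by some game, of size $2 \cdot 2^n$ for example: Alice connects
  \<open>Source\<close> to a pipe indexed by \<open>x\<close>, and Bob returns the water through a fresh pipe for each
  \<open>x\<close> with value 0. So the minimum exists.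
\<close>

definition GH :: "nat \<Rightarrow> (bool list \<Rightarrow> bool list \<Rightarrow> bool) \<Rightarrow> nat" where
  "GH n h = (LEAST s. \<exists>EA EB. garden_hose_game n s EA EB \<and> computes n s EA EB h)"

definition exponential :: "(nat \<Rightarrow> nat) \<Rightarrow> bool" where
  "exponential g \<longleftrightarrow>
     (\<exists>c::real. c > 0 \<and> (\<forall>\<^sub>F n in sequentially. real (g n) \<ge> 2 powr (c * real n)))"

end

theory Submission
  imports Defs
begin

text \<open>
  Shannon-style counting. Only the edge sets chosen on inputs of length \<open>n\<close> matter, so the games of
  size at most \<open>s\<close> compute at most \<open>(s + 1) * 2 ^ (2 * 2 ^ n * (2 * s + 1)\<^sup>2)\<close> functions: the degree
  condition can be dropped in this count. For \<open>s = 2 ^ (n div 4)\<close> this is eventually smaller than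
  the number \<open>2 ^ (2 ^ n * 2 ^ n)\<close> of all functions.
\<close>

section \<open>Uniqueness of the maximal path\<close>

text \<open>By \<open>forced\<close>, all neighbours of \<open>p ! i\<close> occur at positions up
  to \<open>i + 1\<close> of \<open>p\<close>. A path that has followed \<open>p\<close> up to
  position \<open>i\<close> has used all of these except \<open>p ! (i + 1)\<close>, so it can only
  continue along \<open>p\<close>, and it cannot leave the end of \<open>p\<close> at all.\<close>

lemma path_is_prefix:
  assumes forced: "\<And>i w. i < length p \<Longrightarrow> {p ! i, w} \<in> E \<Longrightarrow> w \<in> set (take (i + 2) p)"
    and "is_path V E q" "hd q = hd p" "p \<noteq> []"
  shows "\<exists>r. p = q @ r"
  using assms(2,3)
proof (induction q rule: rev_induct)
  case Nil
  then show ?case by (simp add: is_path_def)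
next
  case (snoc w q)
  show ?case
  proof (cases "q = []")
    case True
    then show ?thesis
      using snoc.prems \<open>p \<noteq> []\<close> by (cases p) auto
  next
    case False
    then have "is_path V E q" and w: "w \<notin> set q" "{last q, w} \<in> E"
      using snoc.prems by (auto simp: is_path_def successively_append_iff)
    then obtain r where r: "p = q @ r"
      using snoc False by auto
    define i where "i = length q - 1"
    have i: "p ! i = last q" "i < length p" "i + 2 = Suc (length q)"
      using False by (cases q; simp add: i_def r nth_append last_conv_nth)+
    have "w \<in> set (take (i + 2) p)"
      using forced[OF i(2)] w i(1) by simp
    then have "w \<in> set (take 1 r)"
      using w unfolding i(3) r by simp
    then show ?thesis
      using r by (cases r) auto
  qed
qed

text \<open>Serves to evaluate the definite description in \<open>game_path\<close>: it is enough to
  exhibit a path and inspect the neighbours of each of its vertices.\<close>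

lemma maximal_path_from_iff:
  assumes path: "is_path V E p"
    and forced: "\<And>i w. i < length p \<Longrightarrow> {p ! i, w} \<in> E \<Longrightarrow> w \<in> set (take (i + 2) p)"
  shows "maximal_path_from V E (hd p) q \<longleftrightarrow> q = p"
proof
  have ne: "p \<noteq> []"
    using path by (simp add: is_path_def)
  have prefix: "\<exists>r. p = q @ r" if "is_path V E q" "hd q = hd p" for q
    using path_is_prefix[OF forced that ne] by blast
  show "q = p" if q: "maximal_path_from V E (hd p) q"
  proof -
    obtain r where "p = q @ r"
      using prefix[of q] q by (auto simp: maximal_path_from_def)
    then show ?thesis
      using q path by (auto simp: maximal_path_from_def)
  qed
  have "r = []" if "is_path V E (p @ r)" for r
    using prefix[of "p @ r"] that ne by auto
  then show "maximal_path_from V E (hd p) q" if "q = p"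
    using that path by (auto simp: maximal_path_from_def)
qed

section \<open>A game for an arbitrary function\<close>

text \<open>Without some computing game, the \<open>LEAST\<close> in \<open>GH\<close> would carry
  no information. Pipes up to \<open>N\<close> name Alice's input; pipes \<open>N + 1\<close> to
  \<open>2 * N\<close> are the return pipes.\<close>

lemma every_function_computed:
  "\<exists>s EA EB. garden_hose_game n s EA EB \<and> computes n s EA EB h"
proof -
  define N :: nat where "N = 2 ^ n"
  have "card {xs :: bool list. length xs = n} = N"
    using card_lists_length_eq[of "UNIV :: bool set" n] by (simp add: N_def)
  then obtain idx where bij: "bij_betw idx {xs :: bool list. length xs = n} {1..N}"
    using finite_same_card_bij[of "{xs :: bool list. length xs = n}" "{1..N}"]
      finite_lists_length_eq[of "UNIV :: bool set" n] by auto
  have idx: "1 \<le> idx x" "idx x \<le> N" if "length x = n" for x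
    using bij_betwE[OF bij] that by auto
  have idx_eq: "idx x = idx y \<longleftrightarrow> x = y" if "length x = n" "length y = n" for x y
    using bij_betw_imp_inj_on[OF bij] that by (auto simp: inj_on_def)
  have idx_ne: "idx x \<noteq> N + idx y" "N + idx y \<noteq> idx x" if "length x = n" "length y = n" for x y
    using idx(2)[OF that(1)] idx(1)[OF that(2)] by auto
  define EA :: strategy where "EA x = {{Source, PipeA (idx x)}}" for x
  define EB :: strategy where
    "EB y = {{PipeB (idx x), PipeB (N + idx x)} | x. length x = n \<and> \<not> h x y}" for y
  have degA: "degree (EA x) v \<le> 1" for x v
  proof -
    have "{e \<in> EA x. v \<in> e} \<subseteq> {{Source, PipeA (idx x)}}"
      by (auto simp: EA_def)
    from card_mono[OF _ this] show ?thesis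
      by (simp add: degree_def)
  qed
  have degB: "degree (EB y) v \<le> 1" for y v
  proof -
    \<comment> \<open>Either endpoint determines an edge of Bob: \<open>idx\<close> values stay at
      most \<open>N\<close>, so a shared endpoint sits in the same half of the pipes in both
      edges.\<close>
    have "e = e'" if e: "e \<in> EB y" "e' \<in> EB y" "v \<in> e" "v \<in> e'" for e e'
    proof -
      obtain x x' where x: "length x = n" "e = {PipeB (idx x), PipeB (N + idx x)}"
        and x': "length x' = n" "e' = {PipeB (idx x'), PipeB (N + idx x')}"
        using e unfolding EB_def by blast
      have "idx x = idx x'"
        using e(3,4) x(2) x'(2) idx[OF x(1)] idx[OF x'(1)] by auto
      then show ?thesis
        using x x' by simp
    qed
    then have "\<exists>e. {e \<in> EB y. v \<in> e} \<subseteq> {e}"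
      by (cases "\<exists>e. e \<in> EB y \<and> v \<in> e") blast+
    then obtain e where "{e \<in> EB y. v \<in> e} \<subseteq> {e}" ..
    from card_mono[OF _ this] show ?thesis
      by (simp add: degree_def)
  qed
  have all_edgesI: "{u, v} \<in> all_edges V" if "u \<in> V" "v \<in> V" "u \<noteq> v" for u v :: vertex and V
    using that by (auto simp: all_edges_def)
  have game: "garden_hose_game n (2 * N) EA EB"
    unfolding garden_hose_game_def
  proof (intro conjI allI impI ballI degA degB)
    fix x :: "bool list" assume "length x = n"
    then show "EA x \<subseteq> all_edges (A0_side (2 * N))"
      using idx[of x] by (auto simp: EA_def A0_side_def A_side_def intro!: all_edgesI)
  next
    fix y :: "bool list" assume "length y = n"
    show "EB y \<subseteq> all_edges (B_side (2 * N))"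
    proof
      fix e assume "e \<in> EB y"
      then obtain x where x: "length x = n" "e = {PipeB (idx x), PipeB (N + idx x)}"
        by (auto simp: EB_def)
      have "PipeB (idx x) \<in> B_side (2 * N)" "PipeB (N + idx x) \<in> B_side (2 * N)"
        using idx[OF x(1)] by (auto simp: B_side_def)
      moreover have "PipeB (idx x) \<noteq> PipeB (N + idx x)"
        using idx_ne[OF x(1) x(1)] by simp
      ultimately show "e \<in> all_edges (B_side (2 * N))"
        unfolding x(2) by (rule all_edgesI)
    qed
  qed
  have "computes n (2 * N) EA EB h"
    unfolding computes_def
  proof (intro allI impI)
    fix x y :: "bool list" assume x: "length x = n" and y: "length y = n"
    define i where "i = idx x"
    have i: "1 \<le> i" "i \<le> N"
      using idx x by (auto simp: i_def)
    define V where "V = A0_side (2 * N) \<union> B_side (2 * N)"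
    define E where "E = pipes (2 * N) \<union> EA x \<union> EB y"
    have V: "Source \<in> V" "PipeA i \<in> V" "PipeB i \<in> V" "PipeA (N + i) \<in> V" "PipeB (N + i) \<in> V"
      using i by (auto simp: V_def A0_side_def A_side_def B_side_def)
    \<comment> \<open>\<open>J\<close> holds the numbers of the pipes that Bob sends back.
      Describing his edges by numbers instead of inputs makes the neighbours below a matter of
      arithmetic.\<close>
    define J where "J = idx ` {x. length x = n \<and> \<not> h x y}"
    have J: "j \<in> J \<Longrightarrow> 1 \<le> j \<and> j \<le> N" for j
      using idx by (auto simp: J_def)
    then have NJ: "N + i \<notin> J" "\<And>j. j \<in> J \<Longrightarrow> i \<noteq> N + j"
      using i by fastforce+
    have iJ: "i \<in> J \<longleftrightarrow> \<not> h x y"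
      using x by (auto simp: J_def i_def idx_eq)
    have EB: "EB y = (\<lambda>j. {PipeB j, PipeB (N + j)}) ` J"
      by (auto simp: EB_def J_def)
    have E: "e \<in> E \<longleftrightarrow> e = {Source, PipeA i} \<or>
      (\<exists>j\<in>{1..2 * N}. e = {PipeA j, PipeB j}) \<or> (\<exists>j\<in>J. e = {PipeB j, PipeB (N + j)})" for e
      by (simp add: E_def pipes_def EA_def EB i_def image_iff Bex_def disj_ac conj_ac)
    have E1: "{Source, v} \<in> E \<longleftrightarrow> v = PipeA i" for v
      unfolding E doubleton_eq_iff by auto
    have E2: "{PipeA i, v} \<in> E \<longleftrightarrow> v = Source \<or> v = PipeB i" for v
      using i unfolding E doubleton_eq_iff by auto
    have E3: "{PipeB i, v} \<in> E \<longleftrightarrow> v = PipeA i \<or> \<not> h x y \<and> v = PipeB (N + i)" for v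
      using i NJ unfolding E doubleton_eq_iff iJ[symmetric] by auto
    have E4: "{PipeB (N + i), v} \<in> E \<longleftrightarrow> v = PipeA (N + i) \<or> \<not> h x y \<and> v = PipeB i" for v
      using i NJ unfolding E doubleton_eq_iff iJ[symmetric] by auto
    have E5: "{PipeA (N + i), v} \<in> E \<longleftrightarrow> v = PipeB (N + i)" for v
      using i unfolding E doubleton_eq_iff by auto
    \<comment> \<open>The course of the water: it spills at Bob's end of pipe \<open>i\<close> if
      the value is 1; otherwise it crosses to pipe \<open>N + i\<close> and comes out on Alice's
      side.\<close>
    define p where "p = (if h x y then [Source, PipeA i, PipeB i]
      else [Source, PipeA i, PipeB i, PipeB (N + i), PipeA (N + i)])"
    have path: "is_path V E p"
      using i V by (simp add: p_def is_path_def E1 E2 E3 E4)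
    have "w \<in> set (take (i' + 2) p)" if "i' < length p" "{p ! i', w} \<in> E" for i' w
      using that by (cases "h x y") (auto simp: p_def less_Suc_eq E1 E2 E3 E4 E5)
    from maximal_path_from_iff[OF path this]
    have max_iff: "maximal_path_from V E (hd p) q \<longleftrightarrow> q = p" for q .
    have "hd p = Source"
      by (simp add: p_def)
    have "game_path (2 * N) EA EB x y = p"
      unfolding game_path_def V_def[symmetric] E_def[symmetric] \<open>hd p = Source\<close>[symmetric] max_iff by simp
    moreover have "last p \<in> (if h x y then B_side (2 * N) else A0_side (2 * N))"
      using i by (auto simp: p_def A0_side_def A_side_def B_side_def)
    ultimately show "(\<not> h x y \<longrightarrow> last (game_path (2 * N) EA EB x y) \<in> A0_side (2 * N)) \<and>
        (h x y \<longrightarrow> last (game_path (2 * N) EA EB x y) \<in> B_side (2 * N))"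
      by auto
  qed
  with game show ?thesis by blast
qed

lemma GH_attained: "\<exists>EA EB. garden_hose_game n (GH n h) EA EB \<and> computes n (GH n h) EA EB h"
  unfolding GH_def using every_function_computed by (rule LeastI_ex)

section \<open>Counting the games of bounded size\<close>

lemma number_of_functions_le:
  assumes small: "\<And>h. GH n h \<le> s"
  shows "(2 :: nat) ^ (2 ^ n * 2 ^ n) \<le> (s + 1) * 2 ^ (2 * 2 ^ n * (2 * s + 1)\<^sup>2)"
proof -
  define V where "V t = A0_side t \<union> B_side t" for t
  define L where "L = {xs :: bool list. length xs = n}"
  \<comment> \<open>One set of edges serves all sizes \<open>t \<le> s\<close>, since smaller games
    live on a subset of \<open>V s\<close>.\<close>
  define D where "D = all_edges (V s)"
  \<comment> \<open>Strategies are total functions on lists, of which there are infinitely many.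
    Coding their restrictions to \<open>L\<close> as relations \<open>P\<close> and \<open>Q\<close>
    leaves finitely many codes; \<open>F\<close> decodes a triple into the set of input pairs with
    value 1.\<close>
  define F where "F = (\<lambda>(t, P, Q). {(x, y). x \<in> L \<and> y \<in> L \<and>
    last (game_path t (\<lambda>x. P `` {x}) (\<lambda>y. Q `` {y}) x y) \<in> B_side t})"
  define G where "G = {..s} \<times> Pow (L \<times> D) \<times> Pow (L \<times> D)"
  have L: "finite L" "card L = 2 ^ n"
    using finite_lists_length_eq[of "UNIV :: bool set" n] card_lists_length_eq[of "UNIV :: bool set" n]
    by (simp_all add: L_def)
  have disjoint: "A0_side t \<inter> B_side t = {}" for t
    by (auto simp: A0_side_def A_side_def B_side_def)
  have V: "finite (V s)" "card (V s) = 2 * s + 1"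
  proof -
    have fin: "finite (A0_side s)" "finite (B_side s)"
      by (simp_all add: A0_side_def A_side_def B_side_def)
    have "card (A_side s) = s" "card (B_side s) = s"
      by (simp_all add: A_side_def B_side_def card_image inj_on_def)
    moreover have "card (A0_side s) = card (A_side s) + 1"
      by (simp add: A0_side_def A_side_def image_iff)
    ultimately show "finite (V s)" "card (V s) = 2 * s + 1"
      using fin disjoint by (simp_all add: V_def card_Un_disjoint)
  qed
  have D: "finite D" "card D \<le> (2 * s + 1)\<^sup>2"
  proof -
    have fin: "finite (V s \<times> V s)"
      using V(1) by simp
    \<comment> \<open>Counting ordered pairs, loops included, is crude but sufficient.\<close>
    have sub: "D \<subseteq> (\<lambda>(u, v). {u, v}) ` (V s \<times> V s)"
      by (auto simp: D_def all_edges_def)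
    show "finite D"
      by (rule finite_subset[OF sub]) (simp add: fin)
    show "card D \<le> (2 * s + 1)\<^sup>2"
      using surj_card_le[OF fin sub] V(2) by (simp add: card_cartesian_product power2_eq_square)
  qed
  have finG: "finite G"
    using L D by (simp add: G_def)
  have "Pow (L \<times> L) \<subseteq> F ` G"
  proof
    fix H assume "H \<in> Pow (L \<times> L)"
    then have H: "H \<subseteq> L \<times> L" by simp
    define h where "h x y \<longleftrightarrow> (x, y) \<in> H" for x y
    define t where "t = GH n h"
    obtain EA EB where g: "garden_hose_game n t EA EB" and c: "computes n t EA EB h"
      using GH_attained[of n h] by (auto simp: t_def)
    have "t \<le> s" using small by (simp add: t_def)
    then have "A0_side t \<subseteq> V s" "B_side t \<subseteq> V s"
      by (auto simp: V_def A0_side_def A_side_def B_side_def)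
    then have sub: "all_edges (A0_side t) \<subseteq> D" "all_edges (B_side t) \<subseteq> D"
      unfolding D_def all_edges_def by blast+
    define P where "P = Sigma L EA"
    define Q where "Q = Sigma L EB"
    have "EA x \<subseteq> D" "EB x \<subseteq> D" if "x \<in> L" for x
      using g that sub[THEN subset_trans[rotated]] by (simp_all add: garden_hose_game_def L_def)
    then have "(t, P, Q) \<in> G"
      using \<open>t \<le> s\<close> by (auto simp: G_def P_def Q_def)
    moreover have "F (t, P, Q) = H"
    proof -
      have "last (game_path t (\<lambda>x. P `` {x}) (\<lambda>y. Q `` {y}) x y) \<in> B_side t \<longleftrightarrow> h x y"
        if "x \<in> L" "y \<in> L" for x y
      proof -
        have eq: "game_path t (\<lambda>x. P `` {x}) (\<lambda>y. Q `` {y}) x y = game_path t EA EB x y"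
          using that by (simp add: game_path_def P_def Q_def Image_def)
        show ?thesis
          \<comment> \<open>Disjointness of the two sides gives the converse: a path ending with Bob
            excludes the value 0.\<close>
          unfolding eq using c that disjoint[of t] by (auto simp: computes_def L_def)
      qed
      then show ?thesis
        using H by (auto simp: F_def h_def)
    qed
    ultimately show "H \<in> F ` G" by blast
  qed
  then have "card (Pow (L \<times> L)) \<le> card G"
    by (rule surj_card_le[OF finG])
  also have "card G = (s + 1) * 2 ^ (2 * 2 ^ n * card D)"
    using L D by (simp add: G_def card_cartesian_product card_Pow power_add[symmetric] mult_2 add_mult_distrib)
  also have "\<dots> \<le> (s + 1) * 2 ^ (2 * 2 ^ n * (2 * s + 1)\<^sup>2)"
    using D by (intro mult_left_mono power_increasing) auto
  finally show ?thesis
    using L by (simp add: card_cartesian_product card_Pow)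
qed

section \<open>Comparison with the number of all functions\<close>

text \<open>With \<open>N = 2 ^ n\<close>, the exponent in the count grows like
  \<open>8 * N * s ^ 2\<close>, while all functions give \<open>N * N\<close>. As
  \<open>s ^ 4 \<le> N\<close>, the latter wins once \<open>s\<close> is at least 8, which
  \<open>n \<ge> 12\<close> ensures.\<close>

lemma hard_function_exists:
  assumes "n \<ge> 12"
  shows "\<exists>h. 2 ^ (n div 4) < GH n h"
proof (rule ccontr)
  define s :: nat where "s = 2 ^ (n div 4)"
  assume "\<nexists>h. 2 ^ (n div 4) < GH n h"
  then have small: "GH n h \<le> s" for h
    by (simp add: s_def not_less)
  define N :: nat where "N = 2 ^ n"
  have s8: "8 \<le> s"
    using power_increasing[of 3 "n div 4" "2 :: nat"] assms by (simp add: s_def)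
  have "s ^ 4 = 2 ^ (n div 4 * 4)"
    by (simp add: s_def power_mult)
  also have "\<dots> \<le> N"
    unfolding N_def by (intro power_increasing) auto
  finally have sN: "s ^ 4 \<le> N" .
  have "s + 1 \<le> 2 ^ s"
    using less_exp[of s] by (simp add: Suc_le_eq)
  then have "(s + 1) * 2 ^ (2 * N * (2 * s + 1)\<^sup>2) \<le> (2 :: nat) ^ (s + 2 * N * (2 * s + 1)\<^sup>2)"
    unfolding power_add by (rule mult_right_mono) simp
  also have "s + 2 * N * (2 * s + 1)\<^sup>2 < N * N"
  proof -
    \<comment> \<open>The left side is \<open>8 * s ^ 2 + 8 * s + 3\<close>, well below
      \<open>64 * s ^ 2\<close>; the factor 64 is then traded for another
      \<open>s * s\<close>.\<close>
    have "2 * (2 * s + 1)\<^sup>2 + 1 < s * s * (8 * 8)"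
    proof -
      have "s \<le> s * s" "8 * 8 \<le> s * s"
        using s8 by (simp, intro mult_mono) auto
      moreover have "(2 * s + 1)\<^sup>2 = 4 * (s * s) + 4 * s + 1"
        by (simp add: power2_eq_square algebra_simps)
      ultimately show ?thesis
        by linarith
    qed
    also have "\<dots> \<le> s * s * (s * s)"
      using s8 by (intro mult_mono) auto
    also have "\<dots> \<le> N"
      using sN by (simp add: power4_eq_xxxx mult.assoc)
    finally have *: "2 * (2 * s + 1)\<^sup>2 + 1 < N" .
    \<comment> \<open>The stray summand \<open>s\<close> is at most \<open>N\<close>, which accounts
      for the \<open>+ 1\<close> in the bound above.\<close>
    have "s \<le> s ^ 4"
      using s8 by (intro self_le_power) auto
    then have "s + 2 * N * (2 * s + 1)\<^sup>2 \<le> N * (2 * (2 * s + 1)\<^sup>2 + 1)"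
      using sN by (simp add: algebra_simps)
    also have "\<dots> < N * N"
      using * by (intro mult_strict_left_mono) (auto simp: N_def)
    finally show ?thesis .
  qed
  then have "(2 :: nat) ^ (s + 2 * N * (2 * s + 1)\<^sup>2) < 2 ^ (N * N)"
    by (intro power_strict_increasing) auto
  finally show False
    using number_of_functions_le[OF small] by (simp add: N_def)
qed

theorem proposition4p12:
  "\<exists>f :: nat \<Rightarrow> bool list \<Rightarrow> bool list \<Rightarrow> bool. exponential (\<lambda>n. GH n (f n))"
proof -
  \<comment> \<open>Guarding the bound by \<open>n \<ge> 12\<close> makes the choice possible for
    every \<open>n\<close>; the finitely many small cases are arbitrary.\<close>
  have "\<forall>n. \<exists>h. n \<ge> 12 \<longrightarrow> 2 ^ (n div 4) < GH n h"
    using hard_function_exists by blast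
  then obtain f where f: "\<And>n. n \<ge> 12 \<Longrightarrow> 2 ^ (n div 4) < GH n (f n)"
    by metis
  have "2 powr (1 / 8 * real n) \<le> real (GH n (f n))" if "n \<ge> 12" for n
  proof -
    \<comment> \<open>Halving the rate 1/4 to 1/8 absorbs the rounding: the remainder is at most 3,
      and \<open>n div 4\<close> is positive.\<close>
    have "n \<le> 8 * (n div 4)"
      using that mult_div_mod_eq[of 4 n] mod_less_divisor[of 4 n] by linarith
    then have "1 / 8 * real n \<le> real (n div 4)"
      by simp
    then have "2 powr (1 / 8 * real n) \<le> 2 powr real (n div 4)"
      by (intro powr_mono) auto
    also have "\<dots> = real (2 ^ (n div 4))"
      by (simp add: powr_realpow)
    also have "\<dots> \<le> real (GH n (f n))"
      using f[OF that] by (intro of_nat_mono) simp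
    finally show ?thesis .
  qed
  then have "exponential (\<lambda>n. GH n (f n))"
    unfolding exponential_def eventually_sequentially by (intro exI[of _ "1 / 8"]) auto
  then show ?thesis by blast
qed

end
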